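(* Let $A_N=A:M_N\to M_N$ be the trace operator of a hybridized finite element method on the finest mesh, with polynomial degree $p\ge 1$ on the mesh skeleton, and let $M_k$, $J_k$, $I_k$, $Q_{k-1}$ and the Galerkin coarse grid operators $A_{k-1}=Q_{k-1}A_kI_k$ ($k=2,\dots,N$) be as defined in the context. Let $a_k(\kappa,\mu):=\langle A_k\kappa,\mu\rangle_{\mathcal E_k}$ for $\kappa,\mu\in M_k$. Then for all $k=2,3,\dots,N$, $$a_k(I_k\lambda,I_k\lambda)=a_{k-1}(\lambda,\lambda)\qquad\text{for all }\lambda\in M_{k-1}.$$
   Context: Model problem. $\Omega\subset\mathbb R^d$, $d\in\{2,3\}$, is open, bounded and connected; $-\nabla\cdot(\mathbf K\nabla q)=f$ in $\Omega$, $q=g_D$ on $\partial\Omega$, where $\mathbf K$ is a symmetric, bounded, uniformly positive definite tensor, $f\in L^2(\Omega)$ and $g_D\in H^{3/2}(\partial\Omega)$. $\mathcal T_h$ is a conforming partition of $\Omega$ into finitely many elements $T$ with Lipschitz boundaries, and $\mathcal E_h$ is the set of interfaces (called edges) between elements. Trace operator $A$. A hybridized method has element unknowns (polynomial spaces on each $T$) and a trace unknown $\lambda$ that is polynomial of degree $p$ on each edge. On each element one of the following local problems (for all test functions $\mathbf v,w$ in the local spaces) determines the element unknowns from $\lambda$ and $f$; different methods may be used in different elements: (i) HDG: $(\mathbf K^{-1}\mathbf u,\mathbf v)_T-(q,\nabla\cdot\mathbf v)_T+\langle\lambda,\mathbf v\cdot\mathbf n\rangle_{\partial T}=0$, $-(\mathbf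 u,\nabla w)_T+\langle\hat{\mathbf u}\cdot\mathbf n,w\rangle_{\partial T}=(f,w)_T$, with flux $\hat{\mathbf u}\cdot\mathbf n=\mathbf u\cdot\mathbf n+\tau(q-\lambda)$; (ii) hybridized interior penalty DG: $(\mathbf K\nabla q,\nabla w)_T-s_f\langle q-\lambda,\mathbf K\nabla w\cdot\mathbf n\rangle_{\partial T}-\langle\mathbf K\nabla q\cdot\mathbf n,w\rangle_{\partial T}+\langle\tau(q-\lambda),w\rangle_{\partial T}=(f,w)_T$, $s_f\in\{-1,0,1\}$, with flux $\hat{\mathbf u}\cdot\mathbf n=-\mathbf K\nabla q\cdot\mathbf n+\tau(q-\lambda)$; (iii) hybridized mixed methods (Raviart–Thomas or Brezzi–Douglas–Marini spaces): the first equation of (i) together with $(\nabla\cdot\mathbf u,w)_T=(f,w)_T$, with flux $\hat{\mathbf u}\cdot\mathbf n=\mathbf u\cdot\mathbf n$. Here $\tau$ is a stabilization parameter. Expressing the element unknowns through $\lambda$ and imposing the conservation condition $\langle[\![\hat{\mathbf u}\cdot\mathbf n]\!],\mu\rangle_e=0$ for all trace test functions $\mu$ and all edges $e$ (where $[\![\cdot]\!]$ is the sum of the contributions of the two adjacent elements) gives a well-posed linear system $A\lambda=g$ for the trace unknown alone. $A$ need not be symmetric. Multilevel setting. $\mathcal T_1,\dots,\mathcal T_N=\mathcal T_h$ are partitions of $\Omega$ into macro-elements, each macro-element of $\mathcal T_k$ being a union of macro-elements of $\mathcal T_{k+1}$ or, when $p>1$ and $k=N-1$, with $\mathcal T_{N-1}=\mathcal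 T_N$. $\mathcal E_k$ is the set of interfaces (edges) between two macro-elements of $\mathcal T_k$; $\mathcal E_N=\mathcal E_h$. $M_N$ is the space of functions on $\mathcal E_N$ that are polynomials of degree at most $p$ on every $e\in\mathcal E_N$, and for $k\le N-1$, $M_k$ is the space of functions that are polynomials of degree at most $1$ on every $e\in\mathcal E_k$ (with respect to a fixed parametrization of $e$). Each $M_k$ carries the $L^2$ inner product $\langle\cdot,\cdot\rangle_{\mathcal E_k}$. Call a level $k\in\{2,\dots,N\}$ an $h$-level if $p=1$, or if $p>1$ and $k\le N-1$. For an $h$-level $k$, split $\mathcal E_k=\mathcal E_{k,I}\cup\mathcal E_{k,B}$ (disjoint), where $\mathcal E_{k,I}$ are the edges interior to macro-elements of $\mathcal T_{k-1}$ and $\mathcal E_{k,B}$ the edges on their boundaries. Correspondingly $M_k=M_{k,I}\oplus M_{k,B}$ (functions vanishing on $\mathcal E_{k,B}$, respectively on $\mathcal E_{k,I}$), and an operator $A_k:M_k\to M_k$ has blocks $A_{k,II},A_{k,IB},A_{k,BI},A_{k,BB}$. The coarse space satisfies $M_{k-1}\subset M_{k,B}$, and $J_k:M_{k-1}\to M_{k,B}$ is the injection. If $p>1$ and $k=N$, $J_N:M_{N-1}\to M_N$ is the injection of piecewise linear functions into piecewise degree-$p$ polynomials. $J_k^*$ denotes the adjoint of $J_k$ with respect to the $L^2$ inner products. It is assumed that $A_{k,II}$ is invertible on every $h$-level $k$. Intergrid operators. For an $h$-level $k$, $$I_k=\begin{bmatrix}-A_{k,II}^{-1}A_{k,IB}J_k\\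 J_k\end{bmatrix}:M_{k-1}\to M_k,\qquad Q_{k-1}=\begin{bmatrix}-J_k^*A_{k,BI}A_{k,II}^{-1}& J_k^*\end{bmatrix}:M_k\to M_{k-1}.$$ If $p>1$ and $k=N$: $I_N=J_N$ and $Q_{N-1}=J_N^*$. The coarse operators are defined recursively from $A_N=A$ by $A_{k-1}:=Q_{k-1}A_kI_k$, $k=N,\dots,2$. *)

theory Defs
  imports "HOL-Analysis.Analysis" "HOL-Library.Function_Algebras"
begin

section \<open>Polynomials, differential operators, linear maps on function spaces\<close>

text \<open>
  Function spaces are sets of functions; sum, difference and zero of functions are the pointwise
  ones of Function_Algebras.
\<close>

definition polys :: "nat \<Rightarrow> (real^'n \<Rightarrow> real) set" where
  "polys m = {r. \<exists>c :: ('n \<Rightarrow> nat) \<Rightarrow> real.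
     \<forall>x. r x = (\<Sum>\<alpha> | (\<Sum>i\<in>UNIV. \<alpha> i) \<le> m. c \<alpha> * (\<Prod>i\<in>UNIV. (x $ i) ^ \<alpha> i))}"

definition vec_polys :: "nat \<Rightarrow> (real^'n \<Rightarrow> real^'n) set" where
  "vec_polys m = {v. \<forall>i. (\<lambda>x. v x $ i) \<in> polys m}"

definition scalar_poly_space :: "(real^'n \<Rightarrow> real) set \<Rightarrow> bool" where
  "scalar_poly_space U \<longleftrightarrow> (\<exists>m. U \<subseteq> polys m) \<and> 0 \<in> U \<and>
     (\<forall>q\<in>U. \<forall>w\<in>U. q + w \<in> U) \<and> (\<forall>c. \<forall>q\<in>U. (\<lambda>x. c * q x) \<in> U)"

definition vector_poly_space :: "(real^'n \<Rightarrow> real^'n) set \<Rightarrow> bool" where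
  "vector_poly_space U \<longleftrightarrow> (\<exists>m. U \<subseteq> vec_polys m) \<and> 0 \<in> U \<and>
     (\<forall>v\<in>U. \<forall>w\<in>U. v + w \<in> U) \<and> (\<forall>c. \<forall>v\<in>U. (\<lambda>x. c *\<^sub>R v x) \<in> U)"

definition raviart_thomas :: "nat \<Rightarrow> (real^'n \<Rightarrow> real^'n) set" where
  "raviart_thomas r = {v. \<exists>a\<in>vec_polys r. \<exists>b\<in>polys r. v = (\<lambda>x. a x + b x *\<^sub>R x)}"

definition partial :: "'n \<Rightarrow> (real^'n \<Rightarrow> real) \<Rightarrow> real^'n \<Rightarrow> real" where
  "partial i f x = frechet_derivative f (at x) (axis i 1)"

definition gradient :: "(real^'n \<Rightarrow> real) \<Rightarrow> real^'n \<Rightarrow> real^'n" where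
  "gradient f x = (\<chi> i. partial i f x)"

definition divergence :: "(real^'n \<Rightarrow> real^'n) \<Rightarrow> real^'n \<Rightarrow> real" where
  "divergence v x = (\<Sum>i\<in>UNIV. partial i (\<lambda>y. v y $ i) x)"

section \<open>Surface measure and outward normal\<close>

text \<open>
  The surface measure on hypersurfaces of \<open>real^'n\<close> is the Hausdorff measure of dimension
  \<open>CARD('n) - 1\<close>, normalised so that flat pieces have their Lebesgue measure. The Hausdorff outer
  measure is a metric outer measure, hence countably additive on the Borel sets.
\<close>

definition hausdorff_pre :: "nat \<Rightarrow> real \<Rightarrow> 'a::metric_space set \<Rightarrow> ennreal" where
  "hausdorff_pre s \<delta> X =
     (INF U \<in> {U :: nat \<Rightarrow> 'a set. X \<subseteq> (\<Union>i. U i) \<and> (\<forall>i. bounded (U i) \<and> diameter (U i) \<le> \<delta>)}.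
        \<Sum>i. ennreal (unit_ball_vol (real s) * (diameter (U i) / 2) ^ s))"

definition hausdorff_outer :: "nat \<Rightarrow> 'a::metric_space set \<Rightarrow> ennreal" where
  "hausdorff_outer s X = (SUP \<delta>\<in>{0<..}. hausdorff_pre s \<delta> X)"

definition surface :: "(real^'n) measure" where
  "surface = measure_of UNIV (sets borel) (hausdorff_outer (CARD('n) - 1))"

text \<open>
  The unit vector \<open>\<nu>\<close> is the outward normal of \<open>T\<close> at \<open>x\<close> if near \<open>x\<close> the boundary lies in every
  double cone about the hyperplane orthogonal to \<open>\<nu>\<close>. For Lipschitz boundaries it exists and is
  unique almost everywhere (Rademacher).
\<close>

definition is_outer_normal :: "(real^'n) set \<Rightarrow> real^'n \<Rightarrow> real^'n \<Rightarrow> bool" where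
  "is_outer_normal T x \<nu> \<longleftrightarrow> norm \<nu> = 1 \<and>
     (\<forall>\<epsilon>>0. \<exists>r>0. \<forall>y\<in>ball x r.
        ((y - x) \<bullet> \<nu> < - \<epsilon> * norm (y - x) \<longrightarrow> y \<in> interior T) \<and>
        ((y - x) \<bullet> \<nu> > \<epsilon> * norm (y - x) \<longrightarrow> y \<notin> T))"

definition outer_normal :: "(real^'n) set \<Rightarrow> real^'n \<Rightarrow> real^'n" where
  "outer_normal T x = (SOME \<nu>. is_outer_normal T x \<nu>)"

definition lipschitz_boundary :: "(real^'n) set \<Rightarrow> bool" where
  "lipschitz_boundary U \<longleftrightarrow> (\<forall>x\<in>frontier U. \<exists>r>0. \<exists>\<nu> \<phi> C. norm \<nu> = 1 \<and>
     C-lipschitz_on {y. y \<bullet> \<nu> = 0} \<phi> \<and>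
     U \<inter> ball x r = {y \<in> ball x r. \<phi> (y - (y \<bullet> \<nu>) *\<^sub>R \<nu>) < y \<bullet> \<nu>})"

section \<open>Data of the model problem\<close>

definition L2_on :: "(real^'n) set \<Rightarrow> (real^'n \<Rightarrow> real) \<Rightarrow> bool" where
  "L2_on \<Omega> u \<longleftrightarrow> set_borel_measurable lebesgue \<Omega> u \<and> set_integrable lebesgue \<Omega> (\<lambda>x. (u x)\<^sup>2)"

primrec Ck :: "nat \<Rightarrow> (real^'n \<Rightarrow> real) \<Rightarrow> bool" where
  "Ck 0 f \<longleftrightarrow> continuous_on UNIV f"
| "Ck (Suc m) f \<longleftrightarrow> (\<forall>x. f differentiable (at x)) \<and> (\<forall>i. Ck m (partial i f))"

definition test_function :: "(real^'n) set \<Rightarrow> (real^'n \<Rightarrow> real) \<Rightarrow> bool" where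
  "test_function \<Omega> \<phi> \<longleftrightarrow> (\<forall>m. Ck m \<phi>) \<and> (\<exists>C. compact C \<and> C \<subseteq> \<Omega> \<and> (\<forall>x. x \<notin> C \<longrightarrow> \<phi> x = 0))"

definition weak_partial :: "(real^'n) set \<Rightarrow> 'n \<Rightarrow> (real^'n \<Rightarrow> real) \<Rightarrow> (real^'n \<Rightarrow> real) \<Rightarrow> bool" where
  "weak_partial \<Omega> i u w \<longleftrightarrow> (\<forall>\<phi>. test_function \<Omega> \<phi> \<longrightarrow>
     (LINT x:\<Omega>|lebesgue. u x * partial i \<phi> x) = - (LINT x:\<Omega>|lebesgue. w x * \<phi> x))"

definition H2_on :: "(real^'n) set \<Rightarrow> (real^'n \<Rightarrow> real) \<Rightarrow> bool" where
  "H2_on \<Omega> u \<longleftrightarrow> L2_on \<Omega> u \<and> (\<exists>D1 D2.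
     (\<forall>i. L2_on \<Omega> (D1 i) \<and> weak_partial \<Omega> i u (D1 i)) \<and>
     (\<forall>i j. L2_on \<Omega> (D2 i j) \<and> weak_partial \<Omega> j (D1 i) (D2 i j)))"

text \<open>
  \<open>H\<^sup>3\<^sup>/\<^sup>2\<close> of the boundary is the space of traces of \<open>H\<^sup>2\<close> functions. In two and three dimensions
  these are continuous up to the boundary, so that the trace is the restriction.
\<close>

definition H32_boundary :: "(real^'n) set \<Rightarrow> (real^'n \<Rightarrow> real) \<Rightarrow> bool" where
  "H32_boundary \<Omega> g \<longleftrightarrow>
     (\<exists>G. H2_on \<Omega> G \<and> continuous_on (closure \<Omega>) G \<and> (\<forall>x\<in>frontier \<Omega>. g x = G x))"

record 'n pde =
  Tensor :: "real^'n \<Rightarrow> real^'n^'n"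
  Source :: "real^'n \<Rightarrow> real"
  Dirichlet :: "real^'n \<Rightarrow> real"

definition valid_pde :: "(real^'n) set \<Rightarrow> 'n pde \<Rightarrow> bool" where
  "valid_pde \<Omega> P \<longleftrightarrow>
     (\<forall>x\<in>\<Omega>. transpose (Tensor P x) = Tensor P x) \<and>
     (\<forall>i j. set_borel_measurable lebesgue \<Omega> (\<lambda>x. Tensor P x $ i $ j)) \<and>
     bounded (Tensor P ` \<Omega>) \<and>
     (\<exists>c>0. \<forall>x\<in>\<Omega>. \<forall>\<xi>. c * (norm \<xi>)\<^sup>2 \<le> \<xi> \<bullet> (Tensor P x *v \<xi>)) \<and>
     L2_on \<Omega> (Source P) \<and> H32_boundary \<Omega> (Dirichlet P)"

section \<open>Partitions, skeletons and trace spaces\<close>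

text \<open>Elements and macro-elements are compact sets.\<close>

definition partition_of_domain :: "(real^'d) set \<Rightarrow> (real^'d) set set \<Rightarrow> bool" where
  "partition_of_domain \<Omega> \<T> \<longleftrightarrow> finite \<T> \<and> \<Union>\<T> = closure \<Omega> \<and>
     (\<forall>T\<in>\<T>. T \<noteq> {} \<and> compact T \<and> T = closure (interior T)) \<and>
     (\<forall>S\<in>\<T>. \<forall>T\<in>\<T>. S \<noteq> T \<longrightarrow> interior S \<inter> interior T = {})"

text \<open>
  Elements may be curved; each is a bi-Lipschitz image of a polytope, whose faces it inherits;
  conformity means that two elements meet in a common (possibly empty) face.
\<close>

definition conforming :: "(real^'d) set set \<Rightarrow> bool" where
  "conforming \<T> \<longleftrightarrow> (\<exists>(R :: (real^'d) set \<Rightarrow> (real^'d) set) (\<Phi> :: (real^'d) set \<Rightarrow> real^'d \<Rightarrow> real^'d).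
     (\<forall>T\<in>\<T>. polytope (R T) \<and> interior (R T) \<noteq> {} \<and>
        (\<exists>\<Psi> C. homeomorphism (R T) T (\<Phi> T) \<Psi> \<and>
           C-lipschitz_on (R T) (\<Phi> T) \<and> C-lipschitz_on T \<Psi>)) \<and>
     (\<forall>S\<in>\<T>. \<forall>T\<in>\<T>. S \<noteq> T \<longrightarrow>
        (\<exists>F G. F face_of R S \<and> G face_of R T \<and> S \<inter> T = \<Phi> S ` F \<and> S \<inter> T = \<Phi> T ` G)))"

text \<open>
  The domain is intersected in order to exclude boundary pieces; intersections of lower dimension
  are not edges.
\<close>

definition interfaces :: "(real^'d) set \<Rightarrow> (real^'d) set set \<Rightarrow> (real^'d) set set" where
  "interfaces \<Omega> \<T> = {e. \<exists>S\<in>\<T>. \<exists>T\<in>\<T>. S \<noteq> T \<and> e = S \<inter> T \<inter> \<Omega> \<and> emeasure surface e > 0}"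

text \<open>
  A Lipschitz bijection from a bounded Borel set of dimension \<open>d - 1\<close> that does not collapse sets
  of positive measure. Its inverse need not be continuous, so that closed curves or surfaces are
  allowed.
\<close>

definition edge_parametrization ::
  "(real^'m) set \<Rightarrow> (real^'m \<Rightarrow> real^'d) \<Rightarrow> (real^'d) set \<Rightarrow> bool" where
  "edge_parametrization D \<pi> e \<longleftrightarrow> bounded D \<and> D \<in> sets borel \<and> bij_betw \<pi> D e \<and>
     (\<exists>C. C-lipschitz_on D \<pi>) \<and>
     (\<forall>X\<in>sets borel. X \<subseteq> D \<and> \<pi> ` X \<in> null_sets surface \<longrightarrow> X \<in> null_sets lborel)"

text \<open>
  A function on a skeleton may be multi-valued where edges meet; it is therefore a family of
  functions indexed by the edges. Everything outside the edges is normalised to zero.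
\<close>

type_synonym 'd trace_fun = "(real^'d) set \<Rightarrow> real^'d \<Rightarrow> real"

definition skeleton_inner :: "(real^'d) set set \<Rightarrow> 'd trace_fun \<Rightarrow> 'd trace_fun \<Rightarrow> real" where
  "skeleton_inner \<E> \<kappa> \<mu> = (\<Sum>e\<in>\<E>. LINT x:e|surface. \<kappa> e x * \<mu> e x)"

definition restrict_edges :: "(real^'d) set set \<Rightarrow> 'd trace_fun \<Rightarrow> 'd trace_fun" where
  "restrict_edges \<F> \<mu> = (\<lambda>e. if e \<in> \<F> then \<mu> e else 0)"

definition linear_on :: "'d trace_fun set \<Rightarrow> 'd trace_fun set \<Rightarrow> ('d trace_fun \<Rightarrow> 'd trace_fun) \<Rightarrow> bool"
  where
  "linear_on X Y L \<longleftrightarrow> (\<forall>\<kappa>\<in>X. L \<kappa> \<in> Y) \<and> (\<forall>\<kappa>\<in>X. \<forall>\<mu>\<in>X. L (\<kappa> + \<mu>) = L \<kappa> + L \<mu>) \<and>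
     (\<forall>c. \<forall>\<kappa>\<in>X. L (\<lambda>e x. c * \<kappa> e x) = (\<lambda>e x. c * L \<kappa> e x))"

record ('d::finite, 'm::finite) hierarchy =
  Dom :: "(real^'d) set"
  Levels :: nat
  Deg :: nat
  Part :: "nat \<Rightarrow> (real^'d) set set"
  Pdom :: "(real^'d) set \<Rightarrow> (real^'m) set"
  Pmap :: "(real^'d) set \<Rightarrow> real^'m \<Rightarrow> real^'d"

definition edges :: "('d::finite, 'm::finite) hierarchy \<Rightarrow> nat \<Rightarrow> (real^'d) set set" where
  "edges H k = interfaces (Dom H) (Part H k)"

definition trace_degree :: "('d::finite, 'm::finite) hierarchy \<Rightarrow> nat \<Rightarrow> nat" where
  "trace_degree H k = (if k = Levels H then Deg H else 1)"

definition M :: "('d::finite, 'm::finite) hierarchy \<Rightarrow> nat \<Rightarrow> 'd trace_fun set" where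
  "M H k = {\<mu>. (\<forall>e\<in>edges H k. (\<exists>r\<in>polys (trace_degree H k). \<forall>t\<in>Pdom H e. \<mu> e (Pmap H e t) = r t) \<and>
                              (\<forall>x. x \<notin> e \<longrightarrow> \<mu> e x = 0)) \<and>
               (\<forall>e. e \<notin> edges H k \<longrightarrow> \<mu> e = 0)}"

definition inner_M :: "('d::finite, 'm::finite) hierarchy \<Rightarrow> nat \<Rightarrow> 'd trace_fun \<Rightarrow> 'd trace_fun \<Rightarrow> real" where
  "inner_M H k = skeleton_inner (edges H k)"

definition h_level :: "('d::finite, 'm::finite) hierarchy \<Rightarrow> nat \<Rightarrow> bool" where
  "h_level H k \<longleftrightarrow> 2 \<le> k \<and> k \<le> Levels H \<and> (Deg H = 1 \<or> Deg H > 1 \<and> k < Levels H)"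

text \<open>
  An edge that is not contained in the boundary of a macro-element of the coarser partition is
  interior to one of them (up to its end points).
\<close>

definition edges_B :: "('d::finite, 'm::finite) hierarchy \<Rightarrow> nat \<Rightarrow> (real^'d) set set" where
  "edges_B H k = {e \<in> edges H k. \<exists>P\<in>Part H (k - 1). e \<subseteq> frontier P}"

definition edges_I :: "('d::finite, 'm::finite) hierarchy \<Rightarrow> nat \<Rightarrow> (real^'d) set set" where
  "edges_I H k = edges H k - edges_B H k"

definition M_I :: "('d::finite, 'm::finite) hierarchy \<Rightarrow> nat \<Rightarrow> 'd trace_fun set" where
  "M_I H k = {\<mu> \<in> M H k. \<forall>e\<in>edges_B H k. \<mu> e = 0}"

definition M_B :: "('d::finite, 'm::finite) hierarchy \<Rightarrow> nat \<Rightarrow> 'd trace_fun set" where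
  "M_B H k = {\<mu> \<in> M H k. \<forall>e\<in>edges_I H k. \<mu> e = 0}"

text \<open>
  On an \<open>h\<close>-level a function on the coarse skeleton is viewed as a function on the fine one: on
  each fine edge it is the restriction from the coarse edge containing it.
\<close>

definition J :: "('d::finite, 'm::finite) hierarchy \<Rightarrow> nat \<Rightarrow> 'd trace_fun \<Rightarrow> 'd trace_fun" where
  "J H k \<eta> = (if h_level H k
     then (\<lambda>e x. if e \<in> edges_B H k \<and> x \<in> e
                 then \<eta> (THE e'. e' \<in> edges H (k - 1) \<and> e \<subseteq> e') x else 0)
     else \<eta>)"

definition J_codomain :: "('d::finite, 'm::finite) hierarchy \<Rightarrow> nat \<Rightarrow> 'd trace_fun set" where
  "J_codomain H k = (if h_level H k then M_B H k else M H k)"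

definition is_adjoint_J :: "('d::finite, 'm::finite) hierarchy \<Rightarrow> nat \<Rightarrow> ('d trace_fun \<Rightarrow> 'd trace_fun) \<Rightarrow> bool" where
  "is_adjoint_J H k L \<longleftrightarrow> linear_on (J_codomain H k) (M H (k - 1)) L \<and>
     (\<forall>\<eta>\<in>M H (k - 1). \<forall>\<mu>\<in>J_codomain H k. inner_M H k (J H k \<eta>) \<mu> = inner_M H (k - 1) \<eta> (L \<mu>))"

definition valid_hierarchy :: "('d::finite, 'm::finite) hierarchy \<Rightarrow> bool" where
  "valid_hierarchy H \<longleftrightarrow>
     CARD('d) \<in> {2, 3} \<and> CARD('d) = CARD('m) + 1 \<and>
     open (Dom H) \<and> bounded (Dom H) \<and> connected (Dom H) \<and>
     1 \<le> Levels H \<and> 1 \<le> Deg H \<and>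
     (\<forall>k\<in>{1..Levels H}. partition_of_domain (Dom H) (Part H k)) \<and>
     conforming (Part H (Levels H)) \<and>
     (\<forall>T\<in>Part H (Levels H). interior T \<subseteq> Dom H \<and> lipschitz_boundary (interior T)) \<and>
     (\<forall>k\<in>{1..<Levels H}. \<forall>P\<in>Part H k. \<exists>\<S>\<subseteq>Part H (k + 1). P = \<Union>\<S>) \<and>
     (Deg H > 1 \<and> 2 \<le> Levels H \<longrightarrow> Part H (Levels H - 1) = Part H (Levels H)) \<and>
     (\<forall>k\<in>{1..Levels H}. \<forall>e\<in>edges H k. edge_parametrization (Pdom H e) (Pmap H e) e) \<and>
     (\<forall>k. h_level H k \<longrightarrow> (\<forall>\<eta>\<in>M H (k - 1). J H k \<eta> \<in> M_B H k))"

section \<open>Hybridized methods and the trace operator\<close>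

text \<open>
  The number carried by the interior penalty method is \<open>s\<^sub>f\<close>; those carried by the mixed methods
  are the orders of the Raviart--Thomas and Brezzi--Douglas--Marini spaces.
\<close>

datatype hybrid_method = HDG | Hybrid_IPDG real | Hybrid_RT nat | Hybrid_BDM nat

record 'd discretization =
  Method :: "(real^'d) set \<Rightarrow> hybrid_method"
  Vspace :: "(real^'d) set \<Rightarrow> (real^'d \<Rightarrow> real^'d) set"
  Wspace :: "(real^'d) set \<Rightarrow> (real^'d \<Rightarrow> real) set"
  Stab :: "(real^'d) set \<Rightarrow> real^'d \<Rightarrow> real"

text \<open>
  The interior penalty method has no vector unknown, which is encoded by a zero space.
\<close>

definition valid_discretization :: "(real^'d) set set \<Rightarrow> 'd discretization \<Rightarrow> bool" where
  "valid_discretization \<T> X \<longleftrightarrow> (\<forall>T\<in>\<T>.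
     vector_poly_space (Vspace X T) \<and> scalar_poly_space (Wspace X T) \<and>
     set_borel_measurable surface (frontier T) (Stab X T) \<and> bounded (Stab X T ` frontier T) \<and>
     (case Method X T of
        HDG \<Rightarrow> True
      | Hybrid_IPDG s \<Rightarrow> s \<in> {-1, 0, 1} \<and> Vspace X T = {0}
      | Hybrid_RT r \<Rightarrow> Vspace X T = raviart_thomas r \<and> Wspace X T = polys r
      | Hybrid_BDM r \<Rightarrow> 1 \<le> r \<and> Vspace X T = vec_polys r \<and> Wspace X T = polys (r - 1)))"

text \<open>
  The trace unknown as a function on element boundaries, equal to the Dirichlet datum on the
  boundary of the domain. At most one summand is nonzero outside a null set.
\<close>

definition boundary_value :: "('d::finite, 'm::finite) hierarchy \<Rightarrow> 'd pde \<Rightarrow> 'd trace_fun \<Rightarrow> real^'d \<Rightarrow> real" where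
  "boundary_value H P \<eta> x =
     (if x \<in> frontier (Dom H) then Dirichlet P x else \<Sum>e\<in>edges H (Levels H). \<eta> e x)"

text \<open>
  On the boundary of an element the tensor, which may jump across edges, is taken as its limit
  from within the element.
\<close>

definition boundary_tensor :: "'d pde \<Rightarrow> (real^'d) set \<Rightarrow> real^'d \<Rightarrow> real^'d^'d" where
  "boundary_tensor P T x = Lim (at x within interior T) (Tensor P)"

definition vol_int :: "(real^'d) set \<Rightarrow> (real^'d \<Rightarrow> real) \<Rightarrow> real" where
  "vol_int T h = (LINT x:interior T|lebesgue. h x)"

definition bd_int :: "(real^'d) set \<Rightarrow> (real^'d \<Rightarrow> real) \<Rightarrow> real" where
  "bd_int T h = (LINT x:frontier T|surface. h x)"

text \<open>In the following, \<open>l\<close> is the trace unknown as a function on the boundary of the element.\<close>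

definition normal_flux ::
  "'d pde \<Rightarrow> 'd discretization \<Rightarrow> (real^'d) set \<Rightarrow> (real^'d \<Rightarrow> real) \<Rightarrow>
   (real^'d \<Rightarrow> real^'d) \<Rightarrow> (real^'d \<Rightarrow> real) \<Rightarrow> real^'d \<Rightarrow> real" where
  "normal_flux P X T l u q x =
     (case Method X T of
        HDG \<Rightarrow> u x \<bullet> outer_normal T x + Stab X T x * (q x - l x)
      | Hybrid_IPDG s \<Rightarrow>
          - ((boundary_tensor P T x *v gradient q x) \<bullet> outer_normal T x) + Stab X T x * (q x - l x)
      | Hybrid_RT r \<Rightarrow> u x \<bullet> outer_normal T x
      | Hybrid_BDM r \<Rightarrow> u x \<bullet> outer_normal T x)"

definition flux_equation ::
  "'d pde \<Rightarrow> 'd discretization \<Rightarrow> (real^'d) set \<Rightarrow> (real^'d \<Rightarrow> real) \<Rightarrow>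
   (real^'d \<Rightarrow> real^'d) \<Rightarrow> (real^'d \<Rightarrow> real) \<Rightarrow> bool" where
  "flux_equation P X T l u q \<longleftrightarrow> (\<forall>v\<in>Vspace X T.
     vol_int T (\<lambda>x. (matrix_inv (Tensor P x) *v u x) \<bullet> v x)
     - vol_int T (\<lambda>x. q x * divergence v x)
     + bd_int T (\<lambda>x. l x * (v x \<bullet> outer_normal T x)) = 0)"

definition mixed_balance ::
  "'d pde \<Rightarrow> 'd discretization \<Rightarrow> (real^'d) set \<Rightarrow> (real^'d \<Rightarrow> real^'d) \<Rightarrow> bool" where
  "mixed_balance P X T u \<longleftrightarrow> (\<forall>w\<in>Wspace X T.
     vol_int T (\<lambda>x. divergence u x * w x) = vol_int T (\<lambda>x. Source P x * w x))"

definition local_solution ::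
  "'d pde \<Rightarrow> 'd discretization \<Rightarrow> (real^'d) set \<Rightarrow> (real^'d \<Rightarrow> real) \<Rightarrow>
   (real^'d \<Rightarrow> real^'d) \<Rightarrow> (real^'d \<Rightarrow> real) \<Rightarrow> bool" where
  "local_solution P X T l u q \<longleftrightarrow> u \<in> Vspace X T \<and> q \<in> Wspace X T \<and>
     (case Method X T of
        HDG \<Rightarrow> flux_equation P X T l u q \<and>
          (\<forall>w\<in>Wspace X T.
             - vol_int T (\<lambda>x. u x \<bullet> gradient w x)
             + bd_int T (\<lambda>x. normal_flux P X T l u q x * w x) = vol_int T (\<lambda>x. Source P x * w x))
      | Hybrid_IPDG s \<Rightarrow>
          (\<forall>w\<in>Wspace X T.
             vol_int T (\<lambda>x. (Tensor P x *v gradient q x) \<bullet> gradient w x)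
             - s * bd_int T (\<lambda>x. (q x - l x) *
                     ((boundary_tensor P T x *v gradient w x) \<bullet> outer_normal T x))
             - bd_int T (\<lambda>x. ((boundary_tensor P T x *v gradient q x) \<bullet> outer_normal T x) * w x)
             + bd_int T (\<lambda>x. Stab X T x * (q x - l x) * w x) = vol_int T (\<lambda>x. Source P x * w x))
      | Hybrid_RT r \<Rightarrow> flux_equation P X T l u q \<and> mixed_balance P X T u
      | Hybrid_BDM r \<Rightarrow> flux_equation P X T l u q \<and> mixed_balance P X T u)"

definition jump ::
  "('d::finite, 'm::finite) hierarchy \<Rightarrow> 'd pde \<Rightarrow> 'd discretization \<Rightarrow> 'd trace_fun \<Rightarrow>
   ((real^'d) set \<Rightarrow> real^'d \<Rightarrow> real^'d) \<Rightarrow> ((real^'d) set \<Rightarrow> real^'d \<Rightarrow> real) \<Rightarrow>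
   (real^'d) set \<Rightarrow> real^'d \<Rightarrow> real" where
  "jump H P X \<eta> u q e x = (\<Sum>T | T \<in> Part H (Levels H) \<and> e \<subseteq> T.
     normal_flux P X T (boundary_value H P \<eta>) (u T) (q T) x)"

text \<open>
  With the element unknowns expressed through the trace unknown \<open>\<eta>\<close>, the jump of the flux is
  affine in \<open>\<eta>\<close>; up to a common sign, the operator is its linear part and \<open>g\<close> is minus its constant
  part. The sign \<open>\<sigma>\<close> leaves open whether the conservation condition is multiplied by \<open>-1\<close>.
\<close>

definition trace_operator ::
  "('d::finite, 'm::finite) hierarchy \<Rightarrow> 'd pde \<Rightarrow> 'd discretization \<Rightarrow> ('d trace_fun \<Rightarrow> 'd trace_fun) \<Rightarrow> bool" where
  "trace_operator H P X A \<longleftrightarrow>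
     (let N = Levels H in
      linear_on (M H N) (M H N) A \<and> bij_betw A (M H N) (M H N) \<and>
      (\<forall>\<eta>\<in>M H N. \<forall>T\<in>Part H N.
         \<exists>!uq. local_solution P X T (boundary_value H P \<eta>) (fst uq) (snd uq)) \<and>
      (\<exists>\<sigma>\<in>{-1, 1}. \<exists>g\<in>M H N. \<forall>\<eta>\<in>M H N. \<forall>u q.
         (\<forall>T\<in>Part H N. local_solution P X T (boundary_value H P \<eta>) (u T) (q T)) \<longrightarrow>
         (\<forall>\<mu>\<in>M H N. \<forall>e\<in>edges H N.
            (LINT x:e|surface. jump H P X \<eta> u q e x * \<mu> e x) =
            \<sigma> * (LINT x:e|surface. (A \<eta> e x - g e x) * \<mu> e x))))"

section \<open>Intergrid transfer and coarse operators\<close>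

definition block ::
  "('d trace_fun \<Rightarrow> 'd trace_fun) \<Rightarrow> (real^'d) set set \<Rightarrow> (real^'d) set set \<Rightarrow> 'd trace_fun \<Rightarrow> 'd trace_fun"
  where
  "block A \<F> \<G> \<mu> = restrict_edges \<F> (A (restrict_edges \<G> \<mu>))"

definition A_II ::
  "('d::finite, 'm::finite) hierarchy \<Rightarrow> nat \<Rightarrow> ('d trace_fun \<Rightarrow> 'd trace_fun) \<Rightarrow> 'd trace_fun \<Rightarrow> 'd trace_fun" where
  "A_II H k A = block A (edges_I H k) (edges_I H k)"

definition A_IB ::
  "('d::finite, 'm::finite) hierarchy \<Rightarrow> nat \<Rightarrow> ('d trace_fun \<Rightarrow> 'd trace_fun) \<Rightarrow> 'd trace_fun \<Rightarrow> 'd trace_fun" where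
  "A_IB H k A = block A (edges_I H k) (edges_B H k)"

definition A_BI ::
  "('d::finite, 'm::finite) hierarchy \<Rightarrow> nat \<Rightarrow> ('d trace_fun \<Rightarrow> 'd trace_fun) \<Rightarrow> 'd trace_fun \<Rightarrow> 'd trace_fun" where
  "A_BI H k A = block A (edges_B H k) (edges_I H k)"

abbreviation inv_A_II ::
  "('d::finite, 'm::finite) hierarchy \<Rightarrow> nat \<Rightarrow> ('d trace_fun \<Rightarrow> 'd trace_fun) \<Rightarrow> 'd trace_fun \<Rightarrow> 'd trace_fun" where
  "inv_A_II H k A \<equiv> inv_into (M_I H k) (A_II H k A)"

text \<open>The operators \<open>I\<^sub>k\<close> and \<open>Q\<^sub>k\<^sub>-\<^sub>1\<close>; \<open>A\<close> is the operator on level \<open>k\<close> and \<open>Js\<close> the adjoint of \<open>J\<close>.\<close>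

definition prolong ::
  "('d::finite, 'm::finite) hierarchy \<Rightarrow> nat \<Rightarrow> ('d trace_fun \<Rightarrow> 'd trace_fun) \<Rightarrow> 'd trace_fun \<Rightarrow> 'd trace_fun" where
  "prolong H k A \<eta> = (if h_level H k
     then - inv_A_II H k A (A_IB H k A (J H k \<eta>)) + J H k \<eta>
     else J H k \<eta>)"

definition restriction ::
  "('d::finite, 'm::finite) hierarchy \<Rightarrow> nat \<Rightarrow> ('d trace_fun \<Rightarrow> 'd trace_fun) \<Rightarrow> ('d trace_fun \<Rightarrow> 'd trace_fun) \<Rightarrow>
   'd trace_fun \<Rightarrow> 'd trace_fun" where
  "restriction H k Js A \<mu> = (if h_level H k
     then - Js (A_BI H k A (inv_A_II H k A (restrict_edges (edges_I H k) \<mu>)))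
          + Js (restrict_edges (edges_B H k) \<mu>)
     else Js \<mu>)"

function level_op ::
  "('d::finite, 'm::finite) hierarchy \<Rightarrow> (nat \<Rightarrow> 'd trace_fun \<Rightarrow> 'd trace_fun) \<Rightarrow> ('d trace_fun \<Rightarrow> 'd trace_fun) \<Rightarrow>
   nat \<Rightarrow> 'd trace_fun \<Rightarrow> 'd trace_fun" where
  "level_op H Js A k =
     (if k < Levels H
      then let A' = level_op H Js A (k + 1)
           in restriction H (k + 1) (Js (k + 1)) A' \<circ> A' \<circ> prolong H (k + 1) A'
      else A)"
  by pat_completeness auto
termination
  by (relation "Wellfounded.measure (\<lambda>(H, Js, A, k). Levels H - k)") auto

declare level_op.simps [simp del]

definition level_form ::
  "('d::finite, 'm::finite) hierarchy \<Rightarrow> (nat \<Rightarrow> 'd trace_fun \<Rightarrow> 'd trace_fun) \<Rightarrow> ('d trace_fun \<Rightarrow> 'd trace_fun) \<Rightarrow>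
   nat \<Rightarrow> 'd trace_fun \<Rightarrow> 'd trace_fun \<Rightarrow> real" where
  "level_form H Js A k \<kappa> \<mu> = inner_M H k (level_op H Js A k \<kappa>) \<mu>"

end

theory Submission
  imports Defs
begin

text \<open>
  On an \<open>h\<close>-level the prolongation of \<open>\<eta>\<close> is the discrete harmonic extension of \<open>J\<^sub>k \<eta>\<close>: the interior
  part of \<open>A\<^sub>k I\<^sub>k \<eta>\<close> vanishes. Hence \<open>Q\<^sub>k\<^sub>-\<^sub>1\<close> acts on \<open>A\<^sub>k I\<^sub>k \<eta>\<close> as the adjoint of \<open>J\<^sub>k\<close>, and in
  \<open>\<langle>A\<^sub>k I\<^sub>k \<eta>, I\<^sub>k \<eta>\<rangle>\<close> only the boundary part \<open>J\<^sub>k \<eta>\<close> of \<open>I\<^sub>k \<eta>\<close> is seen.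
\<close>

section \<open>Subspaces of trace functions and linear maps between them\<close>

definition trace_subspace :: "'d trace_fun set \<Rightarrow> bool" where
  "trace_subspace S \<longleftrightarrow> 0 \<in> S \<and> (\<forall>\<kappa>\<in>S. \<forall>\<mu>\<in>S. \<kappa> + \<mu> \<in> S) \<and>
     (\<forall>c. \<forall>\<kappa>\<in>S. (\<lambda>e x. c * \<kappa> e x) \<in> S)"

text \<open>Neither \<open>linear_on\<close> nor \<open>trace_subspace\<close> mentions negation; as
  scaling by -1 it is covered by their scalar clauses.\<close>

lemma uminus_trace_fun: "- (\<mu> :: 'd trace_fun) = (\<lambda>e x. (-1) * \<mu> e x)"
  by (simp add: fun_eq_iff)

lemma trace_subspaceD:
  assumes "trace_subspace S"
  shows "0 \<in> S"
    and "\<kappa> \<in> S \<Longrightarrow> \<mu> \<in> S \<Longrightarrow> \<kappa> + \<mu> \<in> S"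
    and "\<kappa> \<in> S \<Longrightarrow> (\<lambda>e x. c * \<kappa> e x) \<in> S"
    and "\<kappa> \<in> S \<Longrightarrow> - \<kappa> \<in> S"
  using assms unfolding trace_subspace_def uminus_trace_fun by blast+

lemma linear_onD:
  assumes "linear_on X Y L" and "\<kappa> \<in> X"
  shows "L \<kappa> \<in> Y"
    and "\<mu> \<in> X \<Longrightarrow> L (\<kappa> + \<mu>) = L \<kappa> + L \<mu>"
    and "L (\<lambda>e x. c * \<kappa> e x) = (\<lambda>e x. c * L \<kappa> e x)"
    and "L (- \<kappa>) = - L \<kappa>"
  using assms unfolding linear_on_def uminus_trace_fun by blast+

lemma linear_on_zero:
  assumes "linear_on X Y L" and "0 \<in> X"
  shows "L 0 = 0"
  \<comment> \<open>Homogeneity with factor 0; reading \<open>zero_fun_def\<close> backwards folds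
    the constant zero families into \<open>0\<close>.\<close>
  using linear_onD(3)[OF assms, of 0] by (simp flip: zero_fun_def)

lemma linear_on_mono:
  assumes "linear_on X Y L" and "X' \<subseteq> X" and "Y \<subseteq> Y'"
  shows "linear_on X' Y' L"
  using assms unfolding linear_on_def by blast

lemma linear_on_compose:
  assumes "linear_on X Y L" and "linear_on Y Z K"
  shows "linear_on X Z (\<lambda>\<mu>. K (L \<mu>))"
  using assms unfolding linear_on_def by simp

lemma linear_on_add:
  assumes "linear_on X Y L" and "linear_on X Y K" and "trace_subspace Y"
  shows "linear_on X Y (\<lambda>\<mu>. L \<mu> + K \<mu>)"
  using assms unfolding linear_on_def trace_subspace_def
  by (auto simp: fun_eq_iff algebra_simps)

lemma linear_on_uminus:
  assumes "linear_on X Y L" and "trace_subspace Y"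
  shows "linear_on X Y (\<lambda>\<mu>. - L \<mu>)"
  using assms trace_subspaceD(4)[OF assms(2)] unfolding linear_on_def
  by (auto simp: fun_eq_iff)

text \<open>Since \<open>L\<close> is injective on \<open>X\<close>, an identity for the inverse may
  be checked after applying \<open>L\<close>, where it becomes linearity of \<open>L\<close>
  itself.\<close>

lemma linear_on_inv_into:
  assumes lin: "linear_on X X L" and bij: "bij_betw L X X" and X: "trace_subspace X"
  shows "linear_on X X (inv_into X L)"
proof -
  have mem: "inv_into X L \<mu> \<in> X" if "\<mu> \<in> X" for \<mu>
    using bij that by (metis bij_betw_def inv_into_into)
  have right: "L (inv_into X L \<mu>) = \<mu>" if "\<mu> \<in> X" for \<mu>
    using bij that by (rule bij_betw_inv_into_right)
  \<comment> \<open>Stated for an arbitrary preimage \<nu>, so that each linearity law only has to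
    exhibit its right-hand side as a preimage.\<close>
  have left: "inv_into X L \<mu> = \<nu>" if "\<nu> \<in> X" "L \<nu> = \<mu>" for \<mu> \<nu>
    using bij_betw_inv_into_left[OF bij that(1)] that(2) by simp
  show ?thesis
    unfolding linear_on_def
  proof (intro conjI ballI allI)
    fix \<kappa> \<mu> assume *: "\<kappa> \<in> X" "\<mu> \<in> X"
    show "inv_into X L (\<kappa> + \<mu>) = inv_into X L \<kappa> + inv_into X L \<mu>"
      using * by (intro left) (simp_all add: mem right trace_subspaceD[OF X] linear_onD(2)[OF lin])
  next
    fix c \<kappa> assume *: "\<kappa> \<in> X"
    show "inv_into X L (\<lambda>e x. c * \<kappa> e x) = (\<lambda>e x. c * inv_into X L \<kappa> e x)"
      using * by (intro left) (simp_all add: mem right trace_subspaceD[OF X] linear_onD(3)[OF lin])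
  qed (rule mem)
qed

section \<open>Polynomials and the trace spaces \<open>M H k\<close>\<close>

lemma polys_zero: "(\<lambda>x. 0) \<in> polys m"
  unfolding polys_def by (auto intro!: exI[of _ "\<lambda>\<alpha>. 0"])

lemma polys_add:
  assumes "r \<in> polys m" and "s \<in> polys m"
  shows "(\<lambda>x. r x + s x) \<in> polys m"
proof -
  obtain c d where "\<forall>x. r x = (\<Sum>\<alpha> | (\<Sum>i\<in>UNIV. \<alpha> i) \<le> m. c \<alpha> * (\<Prod>i\<in>UNIV. (x $ i) ^ \<alpha> i))"
    and "\<forall>x. s x = (\<Sum>\<alpha> | (\<Sum>i\<in>UNIV. \<alpha> i) \<le> m. d \<alpha> * (\<Prod>i\<in>UNIV. (x $ i) ^ \<alpha> i))"
    using assms unfolding polys_def by blast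
  then show ?thesis
    unfolding polys_def
    by (intro CollectI exI[of _ "\<lambda>\<alpha>. c \<alpha> + d \<alpha>"]) (simp add: sum.distrib distrib_right)
qed

lemma polys_scale:
  assumes "r \<in> polys m"
  shows "(\<lambda>x. a * r x) \<in> polys m"
proof -
  obtain c where "\<forall>x. r x = (\<Sum>\<alpha> | (\<Sum>i\<in>UNIV. \<alpha> i) \<le> m. c \<alpha> * (\<Prod>i\<in>UNIV. (x $ i) ^ \<alpha> i))"
    using assms unfolding polys_def by blast
  then show ?thesis
    unfolding polys_def
    by (intro CollectI exI[of _ "\<lambda>\<alpha>. a * c \<alpha>"]) (simp add: sum_distrib_left mult.assoc)
qed

text \<open>Each component is at most the total degree, so the multi-indices lie in a finite
  box.\<close>

lemma finite_multi_indices: "finite {\<alpha> :: 'n::finite \<Rightarrow> nat. (\<Sum>i\<in>UNIV. \<alpha> i) \<le> m}"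
proof (rule finite_subset)
  have "\<alpha> i \<le> (\<Sum>i\<in>UNIV. \<alpha> i)" for \<alpha> :: "'n \<Rightarrow> nat" and i
    by (rule member_le_sum) auto
  then show "{\<alpha> :: 'n \<Rightarrow> nat. (\<Sum>i\<in>UNIV. \<alpha> i) \<le> m} \<subseteq> PiE UNIV (\<lambda>_. {..m})"
    by (auto intro: order_trans)
qed (simp add: finite_PiE)

text \<open>The coefficients are padded with zeros above degree \<open>m\<close>. This lets
  piecewise linear traces count as degree-p traces on the finest level.\<close>

lemma polys_mono:
  assumes "m \<le> n"
  shows "(polys m :: (real^'n \<Rightarrow> real) set) \<subseteq> polys n"
proof
  fix r :: "real^'n \<Rightarrow> real" assume "r \<in> polys m"
  then obtain c where c: "\<And>x. r x = (\<Sum>\<alpha> | (\<Sum>i\<in>UNIV. \<alpha> i) \<le> m. c \<alpha> * (\<Prod>i\<in>UNIV. (x $ i) ^ \<alpha> i))"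
    unfolding polys_def by blast
  have "r x = (\<Sum>\<alpha> | (\<Sum>i\<in>UNIV. \<alpha> i) \<le> n.
      (if (\<Sum>i\<in>UNIV. \<alpha> i) \<le> m then c \<alpha> else 0) * (\<Prod>i\<in>UNIV. (x $ i) ^ \<alpha> i))" for x
    unfolding c using assms
    by (intro sum.mono_neutral_cong_left finite_multi_indices) auto
  then show "r \<in> polys n"
    unfolding polys_def by (intro CollectI exI allI)
qed

lemma M_memI:
  assumes "\<And>e. e \<in> edges H k \<Longrightarrow>
      \<exists>r\<in>polys (trace_degree H k). \<forall>t\<in>Pdom H e. \<mu> e (Pmap H e t) = r t"
    and "\<And>e x. e \<in> edges H k \<Longrightarrow> x \<notin> e \<Longrightarrow> \<mu> e x = 0"
    and "\<And>e x. e \<notin> edges H k \<Longrightarrow> \<mu> e x = 0"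
  shows "\<mu> \<in> M H k"
  using assms by (simp add: M_def fun_eq_iff)

lemma M_memD:
  assumes "\<mu> \<in> M H k"
  shows "e \<in> edges H k \<Longrightarrow>
      \<exists>r\<in>polys (trace_degree H k). \<forall>t\<in>Pdom H e. \<mu> e (Pmap H e t) = r t"
    and "e \<in> edges H k \<Longrightarrow> x \<notin> e \<Longrightarrow> \<mu> e x = 0"
    and "e \<notin> edges H k \<Longrightarrow> \<mu> e x = 0"
  using assms by (simp_all add: M_def)

lemma trace_subspace_M: "trace_subspace (M H k)"
  unfolding trace_subspace_def
proof (intro conjI ballI allI)
  show "0 \<in> M H k"
    by (rule M_memI) (simp_all add: bexI[OF _ polys_zero])
next
  fix \<kappa> \<mu> assume \<kappa>: "\<kappa> \<in> M H k" and \<mu>: "\<mu> \<in> M H k"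
  show "\<kappa> + \<mu> \<in> M H k"
  proof (rule M_memI)
    fix e assume e: "e \<in> edges H k"
    obtain r where r: "r \<in> polys (trace_degree H k)" "\<forall>t\<in>Pdom H e. \<kappa> e (Pmap H e t) = r t"
      using M_memD(1)[OF \<kappa> e] by blast
    obtain s where s: "s \<in> polys (trace_degree H k)" "\<forall>t\<in>Pdom H e. \<mu> e (Pmap H e t) = s t"
      using M_memD(1)[OF \<mu> e] by blast
    show "\<exists>r\<in>polys (trace_degree H k). \<forall>t\<in>Pdom H e. (\<kappa> + \<mu>) e (Pmap H e t) = r t"
      using r(2) s(2) by (intro bexI[OF _ polys_add[OF r(1) s(1)]]) simp
  qed (simp_all add: M_memD[OF \<kappa>] M_memD[OF \<mu>])
next
  fix c \<kappa> assume \<kappa>: "\<kappa> \<in> M H k"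
  show "(\<lambda>e x. c * \<kappa> e x) \<in> M H k"
  proof (rule M_memI)
    fix e assume e: "e \<in> edges H k"
    obtain r where r: "r \<in> polys (trace_degree H k)" "\<forall>t\<in>Pdom H e. \<kappa> e (Pmap H e t) = r t"
      using M_memD(1)[OF \<kappa> e] by blast
    show "\<exists>r\<in>polys (trace_degree H k). \<forall>t\<in>Pdom H e. c * \<kappa> e (Pmap H e t) = r t"
      using r(2) by (intro bexI[OF _ polys_scale[OF r(1), of c]]) simp
  qed (simp_all add: M_memD[OF \<kappa>])
qed

section \<open>Splitting into interior and boundary edges; blocks of an operator\<close>

lemma M_I_subset_M: "M_I H k \<subseteq> M H k"
  and M_B_subset_M: "M_B H k \<subseteq> M H k"
  unfolding M_I_def M_B_def by auto

lemma trace_subspace_M_I: "trace_subspace (M_I H k)"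
  using trace_subspace_M[of H k] unfolding trace_subspace_def M_I_def by (auto simp: fun_eq_iff)

text \<open>The polynomial condition in \<open>M\<close> is imposed edge by edge, without continuity
  where edges meet, so setting a function to zero on some edges stays inside
  \<open>M\<close>.\<close>

lemma linear_on_restrict_edges:
  fixes H :: "('d::finite, 'm::finite) hierarchy"
  shows "linear_on (M H k) (M_I H k) (restrict_edges (edges_I H k))"
    and "linear_on (M H k) (M_B H k) (restrict_edges (edges_B H k))"
proof -
  have "restrict_edges \<F> \<mu> \<in> M H k" if \<mu>: "\<mu> \<in> M H k" for \<F> \<mu>
  proof (rule M_memI)
    fix e assume "e \<in> edges H k"
    then show "\<exists>r\<in>polys (trace_degree H k).
        \<forall>t\<in>Pdom H e. restrict_edges \<F> \<mu> e (Pmap H e t) = r t"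
      using M_memD(1)[OF \<mu>] by (cases "e \<in> \<F>") (simp_all add: restrict_edges_def bexI[OF _ polys_zero])
  qed (simp_all add: restrict_edges_def M_memD[OF \<mu>])
  moreover have "restrict_edges \<F> (\<kappa> + \<mu>) = restrict_edges \<F> \<kappa> + restrict_edges \<F> \<mu>"
    "restrict_edges \<F> (\<lambda>e x. c * \<kappa> e x) = (\<lambda>e x. c * restrict_edges \<F> \<kappa> e x)"
    for \<F> c and \<kappa> \<mu> :: "'d trace_fun"
    by (simp_all add: restrict_edges_def fun_eq_iff)
  moreover have "restrict_edges (edges_I H k) \<mu> e = 0" if "e \<in> edges_B H k" for \<mu> e
    using that by (simp add: restrict_edges_def edges_I_def)
  moreover have "restrict_edges (edges_B H k) \<mu> e = 0" if "e \<in> edges_I H k" for \<mu> e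
    using that by (simp add: restrict_edges_def edges_I_def)
  ultimately show "linear_on (M H k) (M_I H k) (restrict_edges (edges_I H k))"
    and "linear_on (M H k) (M_B H k) (restrict_edges (edges_B H k))"
    by (simp_all add: linear_on_def M_I_def M_B_def)
qed

text \<open>A block restricts its argument itself, so it is linear on all of \<open>M H k\<close>
  and not just on one component.\<close>

lemma linear_on_block:
  assumes A: "linear_on (M H k) (M H k) A"
  shows "linear_on (M H k) (M_I H k) (A_II H k A)"
    and "linear_on (M H k) (M_I H k) (A_IB H k A)"
    and "linear_on (M H k) (M_B H k) (A_BI H k A)"
proof -
  note I = linear_on_restrict_edges(1)[of H k] and B = linear_on_restrict_edges(2)[of H k]
  note AI = linear_on_compose[OF linear_on_mono[OF I order_refl M_I_subset_M] A]
  note AB = linear_on_compose[OF linear_on_mono[OF B order_refl M_B_subset_M] A]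
  show "linear_on (M H k) (M_I H k) (A_II H k A)"
    using linear_on_compose[OF AI I] unfolding A_II_def block_def .
  show "linear_on (M H k) (M_I H k) (A_IB H k A)"
    using linear_on_compose[OF AB I] unfolding A_IB_def block_def .
  show "linear_on (M H k) (M_B H k) (A_BI H k A)"
    using linear_on_compose[OF AI B] unfolding A_BI_def block_def .
qed

text \<open>\<open>A_II\<close> ignores values on boundary edges, so its inverse is taken on
  \<open>M_I H k\<close>; the general result on \<open>inv_into\<close> applies after shrinking the
  domain to that space.\<close>

lemma linear_on_inv_A_II:
  assumes "linear_on (M H k) (M H k) A" and "bij_betw (A_II H k A) (M_I H k) (M_I H k)"
  shows "linear_on (M_I H k) (M_I H k) (inv_A_II H k A)"
  using linear_on_mono[OF linear_on_block(1)[OF assms(1)] M_I_subset_M order_refl]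
    assms(2) trace_subspace_M_I by (rule linear_on_inv_into)

section \<open>The injection, the prolongation and the restriction\<close>

lemma J_mem:
  assumes "valid_hierarchy H" and k: "k \<in> {2..Levels H}" and \<eta>: "\<eta> \<in> M H (k - 1)"
  shows "J H k \<eta> \<in> J_codomain H k"
proof (cases "h_level H k")
  case True
  then show ?thesis using assms unfolding valid_hierarchy_def J_codomain_def by simp
next
  case False
  have "1 \<le> Deg H" using assms(1) by (simp add: valid_hierarchy_def)
  \<comment> \<open>Outside the h-levels only the finest level with p > 1 remains. There both
    partitions, hence both skeletons, coincide, \<open>J\<close> is the identity, and the degree
    rises from 1 to p.\<close>
  with False k have N: "k = Levels H" "Deg H > 1" by (auto simp: h_level_def)
  with assms(1) k have "edges H (k - 1) = edges H k"
    by (simp add: valid_hierarchy_def edges_def)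
  moreover have "polys (trace_degree H (k - 1)) \<subseteq> polys (trace_degree H k)"
    using N k by (intro polys_mono) (simp add: trace_degree_def)
  ultimately have "\<eta> \<in> M H k" using \<eta> unfolding M_def by fastforce
  with False show ?thesis by (simp add: J_def J_codomain_def)
qed

lemma linear_on_J:
  assumes "valid_hierarchy H" and "k \<in> {2..Levels H}"
  shows "linear_on (M H (k - 1)) (J_codomain H k) (J H k)"
  using J_mem[OF assms] by (auto simp: linear_on_def J_def fun_eq_iff)

lemma J_codomain_subset_M: "J_codomain H k \<subseteq> M H k"
  unfolding J_codomain_def using M_B_subset_M by auto

lemma linear_on_prolong:
  assumes "valid_hierarchy H" and "k \<in> {2..Levels H}"
    and A: "linear_on (M H k) (M H k) A"
    and bij: "h_level H k \<Longrightarrow> bij_betw (A_II H k A) (M_I H k) (M_I H k)"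
  shows "linear_on (M H (k - 1)) (M H k) (prolong H k A)"
proof -
  have J: "linear_on (M H (k - 1)) (M H k) (J H k)"
    using linear_on_J[OF assms(1,2)] order_refl J_codomain_subset_M by (rule linear_on_mono)
  show ?thesis
  proof (cases "h_level H k")
    case True
    have "linear_on (M H (k - 1)) (M_I H k) (\<lambda>\<eta>. inv_A_II H k A (A_IB H k A (J H k \<eta>)))"
      by (intro linear_on_compose[OF linear_on_compose[OF J linear_on_block(2)[OF A]]]
          linear_on_inv_A_II A bij True)
    \<comment> \<open>The target is widened from \<open>M_I H k\<close> to \<open>M H k\<close>, so
      that the interior correction can be added to \<open>J\<close>.\<close>
    then have "linear_on (M H (k - 1)) (M H k) (\<lambda>\<eta>. inv_A_II H k A (A_IB H k A (J H k \<eta>)))"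
      using order_refl M_I_subset_M by (rule linear_on_mono)
    from linear_on_add[OF linear_on_uminus[OF this trace_subspace_M] J trace_subspace_M] True
    show ?thesis unfolding prolong_def by simp
  next
    case False
    with J show ?thesis unfolding prolong_def by simp
  qed
qed

text \<open>On an h-level \<open>L\<close> is known to be linear only on \<open>M_B H k\<close>.
  Both terms of the restriction respect this: what reaches \<open>L\<close> comes from
  \<open>A_BI\<close> or from cutting down to boundary edges.\<close>

lemma linear_on_restriction:
  assumes A: "linear_on (M H k) (M H k) A"
    and bij: "h_level H k \<Longrightarrow> bij_betw (A_II H k A) (M_I H k) (M_I H k)"
    and L: "is_adjoint_J H k L"
  shows "linear_on (M H k) (M H (k - 1)) (restriction H k L A)"
proof (cases "h_level H k")
  case True
  have L': "linear_on (M_B H k) (M H (k - 1)) L"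
    using L True by (simp add: is_adjoint_J_def J_codomain_def)
  have inv: "linear_on (M H k) (M H k) (\<lambda>\<mu>. inv_A_II H k A (restrict_edges (edges_I H k) \<mu>))"
    by (rule linear_on_mono[OF linear_on_compose[OF linear_on_restrict_edges(1)
            linear_on_inv_A_II[OF A bij[OF True]]] order_refl M_I_subset_M])
  note BI = linear_on_compose[OF linear_on_compose[OF inv linear_on_block(3)[OF A]] L']
  note B = linear_on_compose[OF linear_on_restrict_edges(2) L']
  show ?thesis
    using linear_on_add[OF linear_on_uminus[OF BI trace_subspace_M] B trace_subspace_M] True
    unfolding restriction_def by simp
next
  case False
  with L have "linear_on (M H k) (M H (k - 1)) L"
    by (simp add: is_adjoint_J_def J_codomain_def)
  with False show ?thesis unfolding restriction_def by simp
qed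

section \<open>Linearity of the coarse operators\<close>

lemma level_op_Levels: "level_op H Js A (Levels H) = A"
  by (subst level_op.simps) simp

text \<open>The recursion, shifted to match the indices of Q_{k-1} A_k I_k. The bounds on
  \<open>k\<close> ensure \<open>k - 1 + 1 = k\<close> and \<open>k - 1 < Levels H\<close>.\<close>

lemma level_op_coarse:
  assumes "k \<in> {2..Levels H}"
  shows "level_op H Js A (k - 1) \<eta> =
    restriction H k (Js k) (level_op H Js A k)
      (level_op H Js A k (prolong H k (level_op H Js A k) \<eta>))"
  using assms by (subst level_op.simps) (auto simp: Let_def)

text \<open>Linearity descends from the finest level, each coarsening being a composition of linear
  maps. It is needed to evaluate the operator on the two parts of a prolongation.\<close>

lemma linear_on_level_op:
  assumes "valid_hierarchy H" and "linear_on (M H (Levels H)) (M H (Levels H)) A"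
    and Js: "\<And>k. k \<in> {2..Levels H} \<Longrightarrow> is_adjoint_J H k (Js k)"
    and bij: "\<And>k. h_level H k \<Longrightarrow> bij_betw (A_II H k (level_op H Js A k)) (M_I H k) (M_I H k)"
    and k: "1 \<le> k" "k \<le> Levels H"
  shows "linear_on (M H k) (M H k) (level_op H Js A k)"
  \<comment> \<open>\<open>inc_induct\<close> consumes the upper bound first; the lower bound stays
    in the induction statement and later gives \<open>2 \<le> Suc n\<close>.\<close>
  using k(2,1)
proof (induction k rule: inc_induct)
  case base
  then show ?case using assms(2) by (simp add: level_op_Levels)
next
  case (step n)
  have n: "Suc n \<in> {2..Levels H}" using step.hyps step.prems by simp
  have A: "linear_on (M H (Suc n)) (M H (Suc n)) (level_op H Js A (Suc n))"
    using step.IH by simp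
  have "linear_on (M H n) (M H n) (\<lambda>\<eta>. restriction H (Suc n) (Js (Suc n)) (level_op H Js A (Suc n))
      (level_op H Js A (Suc n) (prolong H (Suc n) (level_op H Js A (Suc n)) \<eta>)))"
    using linear_on_compose[OF linear_on_compose[OF
        linear_on_prolong[OF assms(1) n A bij] A] linear_on_restriction[OF A bij Js[OF n]]]
    by simp
  moreover have "level_op H Js A n = (\<lambda>\<eta>. restriction H (Suc n) (Js (Suc n)) (level_op H Js A (Suc n))
      (level_op H Js A (Suc n) (prolong H (Suc n) (level_op H Js A (Suc n)) \<eta>)))"
    using level_op_coarse[OF n] by (simp add: fun_eq_iff)
  ultimately show ?case by simp
qed

section \<open>Adjointness and discrete harmonic extension\<close>

lemma inner_M_commute: "inner_M H k \<kappa> \<mu> = inner_M H k \<mu> \<kappa>"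
  by (simp add: inner_M_def skeleton_inner_def mult.commute)

text \<open>In \<open>is_adjoint_J\<close> the injection stands in the first argument, in the form
  it stands in the second. Symmetry of the inner product bridges the two; the operator
  \<open>A\<close> itself need not be symmetric.\<close>

lemma adjoint_J_commute:
  assumes "is_adjoint_J H k L" and "\<eta> \<in> M H (k - 1)" and "\<mu> \<in> J_codomain H k"
  shows "inner_M H k \<mu> (J H k \<eta>) = inner_M H (k - 1) (L \<mu>) \<eta>"
  using assms by (simp add: is_adjoint_J_def inner_M_commute)

text \<open>On interior edges \<kappa> vanishes, so the integrands already agree pointwise and the
  integrals are compared edge by edge.\<close>

lemma inner_M_cong_B:
  assumes \<kappa>: "\<kappa> \<in> M_B H k" and \<mu>\<nu>: "\<And>e. e \<in> edges_B H k \<Longrightarrow> \<mu> e = \<nu> e"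
  shows "inner_M H k \<kappa> \<mu> = inner_M H k \<kappa> \<nu>"
proof -
  have "\<kappa> e x * \<mu> e x = \<kappa> e x * \<nu> e x" if "e \<in> edges H k" for e x
    using that \<kappa> \<mu>\<nu>[of e] by (cases "e \<in> edges_B H k") (auto simp: M_B_def edges_I_def)
  then show ?thesis
    unfolding inner_M_def skeleton_inner_def by (intro sum.cong refl) (simp only:)
qed

lemma restrict_edges_M_I:
  assumes "\<mu> \<in> M_I H k"
  shows "restrict_edges (edges_I H k) \<mu> = \<mu>"
  using assms by (auto simp: M_I_def M_def edges_I_def restrict_edges_def fun_eq_iff)

lemma restrict_edges_M_B:
  assumes "\<mu> \<in> M_B H k"
  shows "restrict_edges (edges_B H k) \<mu> = \<mu>" "restrict_edges (edges_I H k) \<mu> = 0"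
proof -
  have "\<mu> e = 0" if "e \<notin> edges_B H k" for e
    using assms that by (cases "e \<in> edges H k") (simp_all add: M_B_def M_def edges_I_def)
  then show "restrict_edges (edges_B H k) \<mu> = \<mu>" "restrict_edges (edges_I H k) \<mu> = 0"
    by (auto simp: edges_I_def restrict_edges_def fun_eq_iff)
qed

text \<open>The interior part of the prolongation solves the interior equations with boundary data
  \<open>J H k \<eta>\<close>, which removes the interior residual. Lying in \<open>M_I H k\<close>,
  it leaves the boundary values untouched.\<close>

lemma prolong_harmonic:
  assumes "valid_hierarchy H" and h: "h_level H k" and \<eta>: "\<eta> \<in> M H (k - 1)"
    and A: "linear_on (M H k) (M H k) A"
    and bij: "bij_betw (A_II H k A) (M_I H k) (M_I H k)"
  shows "A (prolong H k A \<eta>) \<in> M_B H k"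
    and "e \<in> edges_B H k \<Longrightarrow> prolong H k A \<eta> e = J H k \<eta> e"
proof -
  define w where "w = inv_A_II H k A (A_IB H k A (J H k \<eta>))"
  have p: "prolong H k A \<eta> = - w + J H k \<eta>" using h by (simp add: prolong_def w_def)
  have jB: "J H k \<eta> \<in> M_B H k"
    using assms(1) h \<eta> by (simp add: valid_hierarchy_def)
  then have j: "J H k \<eta> \<in> M H k" using M_B_subset_M by blast
  have IB: "A_IB H k A (J H k \<eta>) \<in> M_I H k" using linear_onD(1)[OF linear_on_block(2)[OF A] j] .
  then have wI: "w \<in> M_I H k"
    unfolding w_def using linear_onD(1)[OF linear_on_inv_A_II[OF A bij]] by blast
  then have w: "w \<in> M H k" using M_I_subset_M by blast
  have Aw: "A w \<in> M H k" and Aj: "A (J H k \<eta>) \<in> M H k"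
    using linear_onD(1)[OF A] w j by auto
  \<comment> \<open>By the choice of \<open>w\<close>, the interior parts of \<open>A w\<close> and
    \<open>A (J H k \<eta>)\<close> coincide, so they cancel in
    \<open>A (- w + J H k \<eta>)\<close>.\<close>
  have "restrict_edges (edges_I H k) (A w) = A_II H k A w"
    using wI by (simp add: A_II_def block_def restrict_edges_M_I)
  also have "\<dots> = A_IB H k A (J H k \<eta>)"
    unfolding w_def using bij IB by (rule bij_betw_inv_into_right)
  also have "\<dots> = restrict_edges (edges_I H k) (A (J H k \<eta>))"
    using jB by (simp add: A_IB_def block_def restrict_edges_M_B)
  finally have eq: "A w e = A (J H k \<eta>) e" if "e \<in> edges_I H k" for e
    using that by (metis restrict_edges_def)
  have "A (prolong H k A \<eta>) = - A w + A (J H k \<eta>)"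
    unfolding p linear_onD(2)[OF A trace_subspaceD(4)[OF trace_subspace_M w] j]
      linear_onD(4)[OF A w] ..
  moreover have "- A w + A (J H k \<eta>) \<in> M H k"
    using Aw Aj by (intro trace_subspaceD(2,4)[OF trace_subspace_M])
  ultimately show "A (prolong H k A \<eta>) \<in> M_B H k"
    using eq by (simp add: M_B_def)
  show "prolong H k A \<eta> e = J H k \<eta> e" if "e \<in> edges_B H k"
    using that wI by (simp add: p M_I_def)
qed

text \<open>With no interior part in \<mu>, the first term of Q_{k-1} is the image of 0 under a
  chain of linear maps, and the second is \<open>L \<mu>\<close>.\<close>

lemma restriction_M_B:
  assumes h: "h_level H k" and \<mu>: "\<mu> \<in> M_B H k"
    and A: "linear_on (M H k) (M H k) A"
    and bij: "bij_betw (A_II H k A) (M_I H k) (M_I H k)"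
    and L: "is_adjoint_J H k L"
  shows "restriction H k L A \<mu> = L \<mu>"
proof -
  have "inv_A_II H k A 0 = 0"
    using linear_on_inv_A_II[OF A bij] trace_subspaceD(1)[OF trace_subspace_M_I]
    by (rule linear_on_zero)
  moreover have "A_BI H k A 0 = 0"
    using linear_on_block(3)[OF A] trace_subspaceD(1)[OF trace_subspace_M] by (rule linear_on_zero)
  moreover have "L 0 = 0"
  proof (rule linear_on_zero)
    show "linear_on (M_B H k) (M H (k - 1)) L"
      using L h by (simp add: is_adjoint_J_def J_codomain_def)
    show "0 \<in> M_B H k"
      using trace_subspaceD(1)[OF trace_subspace_M, of H k] by (simp add: M_B_def)
  qed
  ultimately show ?thesis
    using h by (simp add: restriction_def restrict_edges_M_B[OF \<mu>])
qed

section \<open>The energy identity between consecutive levels\<close>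

theorem mainTheorem1:
  fixes H :: "('d::finite, 'm::finite) hierarchy"
    and P :: "'d pde"
    and X :: "'d discretization"
    and A :: "'d trace_fun \<Rightarrow> 'd trace_fun"
    and Js :: "nat \<Rightarrow> 'd trace_fun \<Rightarrow> 'd trace_fun"
  assumes "valid_hierarchy H"
    and "valid_pde (Dom H) P"
    and "valid_discretization (Part H (Levels H)) X"
    and "trace_operator H P X A"
    and "\<And>k. k \<in> {2..Levels H} \<Longrightarrow> is_adjoint_J H k (Js k)"
    and "\<And>k. h_level H k \<Longrightarrow> bij_betw (A_II H k (level_op H Js A k)) (M_I H k) (M_I H k)"
  shows "\<forall>k\<in>{2..Levels H}. \<forall>\<eta>\<in>M H (k - 1).
    level_form H Js A k (prolong H k (level_op H Js A k) \<eta>) (prolong H k (level_op H Js A k) \<eta>) =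
    level_form H Js A (k - 1) \<eta> \<eta>"
proof (intro ballI)
  fix k \<eta>
  assume k: "k \<in> {2..Levels H}" and \<eta>: "\<eta> \<in> M H (k - 1)"
  let ?A = "level_op H Js A k"
  let ?p = "prolong H k ?A \<eta>"
  have "linear_on (M H (Levels H)) (M H (Levels H)) A"
    using assms(4) by (simp add: trace_operator_def Let_def)
  then have A: "linear_on (M H k) (M H k) ?A"
    using k by (intro linear_on_level_op assms(1,5,6)) auto
  note adj = assms(5)[OF k]
  \<comment> \<open>By \<open>level_op_coarse\<close> the right-hand side is the coarse form at
    \<eta>, so this is the claim for level \<open>k\<close>.\<close>
  have "inner_M H k (?A ?p) ?p = inner_M H (k - 1) (restriction H k (Js k) ?A (?A ?p)) \<eta>"
  proof (cases "h_level H k")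
    case True
    note bij = assms(6)[OF True]
    note harmonic = prolong_harmonic[OF assms(1) True \<eta> A bij]
    \<comment> \<open>Since \<open>?A ?p\<close> lies in \<open>M_B H k\<close>, its second partner
      may be replaced by the boundary part of \<open>?p\<close>; then the adjoint carries
      \<open>J\<close> to the coarse level.\<close>
    have "inner_M H k (?A ?p) ?p = inner_M H k (?A ?p) (J H k \<eta>)"
      using harmonic by (rule inner_M_cong_B)
    also have "\<dots> = inner_M H (k - 1) (Js k (?A ?p)) \<eta>"
      using adj \<eta> harmonic(1) True by (intro adjoint_J_commute) (simp_all add: J_codomain_def)
    finally show ?thesis
      using restriction_M_B[OF True harmonic(1) A bij adj] by simp
  next
    case False
    then have p: "?p = J H k \<eta>" by (simp add: prolong_def)
    have "J H k \<eta> \<in> M H k" using J_mem[OF assms(1) k \<eta>] J_codomain_subset_M by blast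
    \<comment> \<open>Here \<open>J_codomain H k\<close> is all of \<open>M H k\<close>, and the
      transfer operators are \<open>J\<close> and its adjoint, so adjointness alone gives the
      identity.\<close>
    then have "?A (J H k \<eta>) \<in> J_codomain H k"
      using linear_onD(1)[OF A] False by (simp add: J_codomain_def)
    then show ?thesis
      unfolding p using adjoint_J_commute[OF adj \<eta>] False by (simp add: restriction_def)
  qed
  then show "level_form H Js A k ?p ?p = level_form H Js A (k - 1) \<eta> \<eta>"
    unfolding level_form_def level_op_coarse[OF k] .
qed

end
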